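(* Let $\nu$ be a Borel probability measure on $\mathbb R$. For $h>0$, $a\in\mathbb R$ and $k\in\mathbb Z$ let $$I_{h,a,k}:=(a+(k-1)h,\,a+kh],\qquad p_{h,a,k}:=\nu(I_{h,a,k}).$$ (i) If $\nu$ is log-concave, then for all $h>0$ and $a\in\mathbb R$ the sequence $(p_{h,a,k})_{k\in\mathbb Z}$ is log-concave, i.e. $p_{h,a,k}^2\ge p_{h,a,k-1}p_{h,a,k+1}$ for all $k\in\mathbb Z$, and its positive support $\{k:p_{h,a,k}>0\}$ is an interval of integers. (ii) Conversely, suppose that for some sequence $h_n\downarrow0$ and origins $a_n\in\mathbb R$ the set $\{k:p_{h_n,a_n,k}>0\}$ is an interval of integers for every $n$ and $$p_{h_n,a_n,k}^2\ge p_{h_n,a_n,k-1}\,p_{h_n,a_n,k+1}\qquad(k\in\mathbb Z).$$ Then $\nu$ is log-concave; (in one dimension) it is either a point mass or has a log-concave density.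
   Context: A measure $\nu$ is called log-concave when it satisfies the Prékopa inequality $\nu((1-\lambda)A+\lambda B)\ge\nu(A)^{1-\lambda}\nu(B)^\lambda$ for all compact sets $A,B$ and all $0<\lambda<1$. *)

theory Defs
  imports "HOL-Probability.Probability"
begin

(* 0 powr s = 0, so the inequality is trivially true when A or B is null,
   in particular when one of them is empty.
   Meant for finite measures: "measure" returns 0 on sets of infinite mass. *)
definition log_concave_measure :: "real measure \<Rightarrow> bool" where
  "log_concave_measure \<nu> \<longleftrightarrow>
     (\<forall>A B. \<forall>l::real. compact A \<and> compact B \<and> 0 < l \<and> l < 1 \<longrightarrow>
        measure \<nu> {(1 - l) * x + l * y | x y. x \<in> A \<and> y \<in> B}
          \<ge> measure \<nu> A powr (1 - l) * measure \<nu> B powr l)"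

definition log_concave_fun :: "(real \<Rightarrow> real) \<Rightarrow> bool" where
  "log_concave_fun f \<longleftrightarrow>
     (\<forall>x. 0 \<le> f x) \<and>
     (\<forall>x y. \<forall>l::real. 0 < l \<and> l < 1 \<longrightarrow>
        f ((1 - l) * x + l * y) \<ge> f x powr (1 - l) * f y powr l)"

definition point_mass :: "real measure \<Rightarrow> bool" where
  "point_mass \<nu> \<longleftrightarrow> (\<exists>x. \<nu> = return borel x)"

definition has_log_concave_density :: "real measure \<Rightarrow> bool" where
  "has_log_concave_density \<nu> \<longleftrightarrow>
     (\<exists>f. f \<in> borel_measurable borel \<and> log_concave_fun f \<and>
          \<nu> = density lborel (\<lambda>x. ennreal (f x)))"

definition cell :: "real \<Rightarrow> real \<Rightarrow> int \<Rightarrow> real set" where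
  "cell h a k = {a + (of_int k - 1) * h <.. a + of_int k * h}"

definition cell_prob :: "real measure \<Rightarrow> real \<Rightarrow> real \<Rightarrow> int \<Rightarrow> real" where
  "cell_prob \<nu> h a k = measure \<nu> (cell h a k)"

definition log_concave_seq :: "(int \<Rightarrow> real) \<Rightarrow> bool" where
  "log_concave_seq p \<longleftrightarrow> (\<forall>k. (p k)\<^sup>2 \<ge> p (k - 1) * p (k + 1))"

(* Possibly empty or unbounded. *)
definition int_interval :: "int set \<Rightarrow> bool" where
  "int_interval S \<longleftrightarrow> (\<forall>i\<in>S. \<forall>k\<in>S. \<forall>j. i \<le> j \<and> j \<le> k \<longrightarrow> j \<in> S)"

end

theory Submission
  imports Defs
begin

text \<open>
  For the converse, moving window sums of a log-concave sequence are again log-concave. Letting the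
  mesh tend to \<open>0\<close> and using only right continuity of the distribution function \<open>F\<close>, every increment
  \<open>x \<mapsto> F (x + d) - F x\<close> is a log-concave function. Letting \<open>d \<rightarrow> \<infinity>\<close>, \<open>F\<close> and \<open>1 - F\<close> are log-concave too,
  so \<open>F\<close> can jump only at a point where it jumps from \<open>0\<close> to \<open>1\<close>. If \<open>F\<close> is continuous, concavity of \<open>ln F\<close> gives a
  right derivative of \<open>F\<close>, bounded on every half-line on which \<open>F\<close> is bounded away from \<open>0\<close>; it is a
  density by dominated convergence, and log-concave as the limit of the log-concave quotients
  \<open>(F (x + d) - F x) / d\<close>. That a log-concave density gives a log-concave measure is the
  one-dimensional Prekopa-Leindler inequality, proved through superlevel sets.
\<close>

section \<open>Log-concave sequences\<close>

text \<open>Induction on \<open>j\<close>: multiply the claim for \<open>j\<close> by the three-term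
  inequality at \<open>j\<close> and cancel \<open>p j * p (j - 1)\<close>. The cancelled factor is
  positive because the support is an interval containing \<open>i\<close> and \<open>j + 1\<close>;
  with gaps the claim fails, as for the values 1, 0, 0, 1.\<close>

lemma log_concave_seq_mult_le:
  fixes p :: "int \<Rightarrow> real"
  assumes lc: "log_concave_seq p" and int: "int_interval {k. p k > 0}" and nn: "\<And>k. 0 \<le> p k"
    and "i < j"
  shows "p i * p j \<le> p (i + 1) * p (j - 1)"
  using \<open>i < j\<close>
proof (induction j rule: int_gr_induct)
  case base
  then show ?case by (simp add: mult.commute)
next
  case (step j)
  show ?case
  proof (cases "p i > 0 \<and> p (j + 1) > 0")
    case False
    then have "p i * p (j + 1) = 0"
      using nn by (metis less_eq_real_def mult_eq_0_iff)
    then show ?thesis using nn[of "i + 1"] nn[of j] by auto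
  next
    case True
    have pos: "p k > 0" if "i \<le> k" "k \<le> j + 1" for k
      using int True that unfolding int_interval_def by blast
    have "p (j - 1) * p (j + 1) \<le> (p j)\<^sup>2"
      using lc by (simp add: log_concave_seq_def)
    then have "(p i * p j) * (p (j - 1) * p (j + 1)) \<le> (p (i + 1) * p (j - 1)) * (p j)\<^sup>2"
      by - (rule mult_mono, use step nn in auto)
    then have "(p i * p (j + 1)) * (p j * p (j - 1)) \<le> (p (i + 1) * p j) * (p j * p (j - 1))"
      by (simp add: power2_eq_square algebra_simps)
    moreover have "p j * p (j - 1) > 0"
      using pos step by (intro mult_pos_pos) auto
    ultimately have "p i * p (j + 1) \<le> p (i + 1) * p j"
      using mult_le_cancel_right_pos by blast
    then show ?thesis by simp
  qed
qed

text \<open>Moving the window one step drops its first term and gains one at the end, so the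
  differences of \<open>W\<close> reduce to boundary terms. The discriminant at \<open>k\<close>
  then splits into two sums, each nonnegative term by term because moving two indices towards each
  other increases their product.\<close>

lemma log_concave_seq_window_sum:
  fixes p :: "int \<Rightarrow> real" and m :: nat
  assumes lc: "log_concave_seq p" and int: "int_interval {k. p k > 0}" and nn: "\<And>k. 0 \<le> p k"
  shows "log_concave_seq (\<lambda>i. \<Sum>t=1..m. p (i + int t))"
  unfolding log_concave_seq_def
proof (intro allI)
  fix k :: int
  define W where "W i = (\<Sum>t=1..m. p (i + int t))" for i
  note ml = log_concave_seq_mult_le[OF lc int nn]
  have shift: "W (i + 1) = W i - p (i + 1) + p (i + 1 + int m)" for i
    unfolding W_def by (induction m) (auto simp: algebra_simps)
  have d1: "W k - W (k + 1) = p (k + 1) - p (k + 1 + int m)"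
    using shift[of k] by simp
  have d0: "W (k - 1) - W k = p k - p (k + int m)"
    using shift[of "k - 1"] by simp
  have "0 \<le> W k * p (k + 1) - W (k + 1) * p k"
    unfolding W_def sum_distrib_right sum_subtractf[symmetric]
  proof (rule sum_nonneg)
    fix t assume "t \<in> {1..m}"
    then show "0 \<le> p (k + int t) * p (k + 1) - p (k + 1 + int t) * p k"
      using ml[of k "k + 1 + int t"] by (simp add: mult.commute algebra_simps)
  qed
  moreover have "0 \<le> W (k + 1) * p (k + int m) - W k * p (k + 1 + int m)"
    unfolding W_def sum_distrib_right sum_subtractf[symmetric]
  proof (rule sum_nonneg)
    fix t assume "t \<in> {1..m}"
    then show "0 \<le> p (k + 1 + int t) * p (k + int m) - p (k + int t) * p (k + 1 + int m)"
      using ml[of "k + int t" "k + 1 + int m"] by (simp add: algebra_simps)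
  qed
  moreover have "(W k)\<^sup>2 - W (k - 1) * W (k + 1) = W k * (W k - W (k + 1)) - W (k + 1) * (W (k - 1) - W k)"
    by (simp add: power2_eq_square algebra_simps)
  ultimately show "W (k - 1) * W (k + 1) \<le> (W k)\<^sup>2"
    unfolding d0 d1 by (simp add: algebra_simps)
qed

text \<open>The sum at \<open>i\<close> is positive exactly when the window from
  \<open>i + 1\<close> to \<open>i + m\<close> meets the support of \<open>p\<close>.\<close>

lemma int_interval_window_sum:
  fixes p :: "int \<Rightarrow> real" and m :: nat
  assumes int: "int_interval {k. p k > 0}" and nn: "\<And>k. 0 \<le> p k"
  shows "int_interval {i. (\<Sum>t=1..m. p (i + int t)) > 0}"
proof -
  have iff: "(\<Sum>t=1..m. p (i + int t)) > 0 \<longleftrightarrow> (\<exists>s. i < s \<and> s \<le> i + int m \<and> p s > 0)" for i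
  proof
    assume "(\<Sum>t=1..m. p (i + int t)) > 0"
    then obtain t where "t \<in> {1..m}" "p (i + int t) > 0"
      by (meson not_le sum_nonpos)
    then show "\<exists>s. i < s \<and> s \<le> i + int m \<and> p s > 0"
      by (intro exI[of _ "i + int t"]) auto
  next
    assume "\<exists>s. i < s \<and> s \<le> i + int m \<and> p s > 0"
    then obtain s where s: "i < s" "s \<le> i + int m" "p s > 0" by blast
    have "nat (s - i) \<in> {1..m}" "p (i + int (nat (s - i))) > 0"
      using s by auto
    then show "(\<Sum>t=1..m. p (i + int t)) > 0"
      using nn by (intro sum_pos2[where i = "nat (s - i)"]) auto
  qed
  show ?thesis
    unfolding int_interval_def mem_Collect_eq iff
  proof safe
    fix i k j s t
    assume h: "i \<le> j" "j \<le> k" "i < s" "s \<le> i + int m" "p s > 0" "k < t" "t \<le> k + int m" "p t > 0"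
    \<comment> \<open>If neither \<open>s\<close> nor \<open>t\<close> lies in the window of
      \<open>j\<close>, the window separates them. Then \<open>j + 1\<close> lies between two
      support points, and it belongs to the window since \<open>i < s \<le> i + m\<close> forces
      \<open>m \<ge> 1\<close>.\<close>
    consider "j < s" | "t \<le> j + int m" | "s \<le> j" "j + int m < t" by linarith
    then show "\<exists>s>j. s \<le> j + int m \<and> p s > 0"
    proof cases
      case 3
      have "p (j + 1) > 0"
        using int h 3 unfolding int_interval_def by (smt (verit) mem_Collect_eq)
      then show ?thesis using h by (intro exI[of _ "j + 1"]) auto
    qed (use h in force)+
  qed
qed

text \<open>The increments \<open>d\<close> of \<open>ln p\<close> decrease, so \<open>ln p\<close>
  is discretely concave: on either side of \<open>k\<close> its average slope is compared with the
  single slope \<open>d k\<close>.\<close>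

lemma log_concave_seq_interpolate:
  fixes p :: "int \<Rightarrow> real"
  assumes lc: "log_concave_seq p" and int: "int_interval {k. p k > 0}" and nn: "\<And>k. 0 \<le> p k"
    and ij: "i < j" and k: "i \<le> k" "k \<le> j"
  shows "p i powr (of_int (j - k) / of_int (j - i)) * p j powr (of_int (k - i) / of_int (j - i)) \<le> p k"
proof (cases "p i > 0 \<and> p j > 0")
  case False
  then have "p i = 0 \<or> p j = 0" using nn by (metis less_eq_real_def)
  then show ?thesis using nn by auto
next
  case True
  have pos: "p t > 0" if "i \<le> t" "t \<le> j" for t
    using int True that unfolding int_interval_def by blast
  define d where "d t = ln (p (t + 1)) - ln (p t)" for t
  have d_mono: "d t \<le> d s" if "i \<le> s" "s \<le> t" "t < j" for s t
  proof -
    have "d t \<le> d s"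
      using that(2,3)
    proof (induction t rule: int_ge_induct)
      case (step t)
      have "p t * p (t + 2) \<le> p (t + 1) * p (t + 1)"
        using log_concave_seq_mult_le[OF lc int nn, of t "t + 2"] by (simp add: ac_simps)
      then have "ln (p t * p (t + 2)) \<le> ln (p (t + 1) * p (t + 1))"
        using pos[of t] pos[of "t+1"] pos[of "t+2"] step that
        by (subst ln_le_cancel_iff) auto
      then have "d (t + 1) \<le> d t"
        using pos[of t] pos[of "t+1"] pos[of "t+2"] step that
        by (simp add: ln_mult_pos d_def add.assoc)
      then show ?case using step by auto
    qed simp
    then show ?thesis .
  qed
  \<comment> \<open>The bound requires \<open>k < j\<close> because \<open>d k\<close> involves
    \<open>p (k + 1)\<close>, whose positivity is known only up to \<open>j\<close>.\<close>
  have left: "of_int (k - i) * d k \<le> ln (p k) - ln (p i)" if "k < j"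
  proof -
    have "of_int (s - i) * d k \<le> ln (p s) - ln (p i)" if "i \<le> s" "s \<le> k" for s
      using that
    proof (induction s rule: int_ge_induct)
      case (step s)
      then have "d k \<le> d s" using d_mono[of s k] \<open>k < j\<close> by auto
      with step show ?case by (simp add: d_def algebra_simps)
    qed simp
    then show ?thesis using k by auto
  qed
  have right: "ln (p j) - ln (p k) \<le> of_int (j - k) * d k"
  proof -
    have "ln (p s) - ln (p k) \<le> of_int (s - k) * d k" if "k \<le> s" "s \<le> j" for s
      using that
    proof (induction s rule: int_ge_induct)
      case (step s)
      then have "d s \<le> d k" using d_mono[of k s] k by auto
      with step show ?case by (simp add: d_def algebra_simps)
    qed simp
    then show ?thesis using k by auto
  qed
  have "of_int (j - k) * ln (p i) + of_int (k - i) * ln (p j) \<le> of_int (j - i) * ln (p k)"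
  proof (cases "k = j")
    case False
    with k have "k < j" by simp
    \<comment> \<open>The weights \<open>j - k\<close> and \<open>k - i\<close> are chosen so that
      \<open>d k\<close> cancels between the two slope bounds.\<close>
    have "of_int (j - k) * (of_int (k - i) * d k) \<le> of_int (j - k) * (ln (p k) - ln (p i))"
      using left[OF \<open>k < j\<close>] k by (intro mult_left_mono) auto
    moreover have "of_int (k - i) * (ln (p j) - ln (p k)) \<le> of_int (k - i) * (of_int (j - k) * d k)"
      using right k by (intro mult_left_mono) auto
    ultimately show ?thesis by (simp add: algebra_simps)
  qed simp
  then have "of_int (j - k) / of_int (j - i) * ln (p i) + of_int (k - i) / of_int (j - i) * ln (p j) \<le> ln (p k)"
    using ij by (simp add: pos_divide_le_eq mult.commute flip: add_divide_distrib)
  then have "exp (of_int (j - k) / of_int (j - i) * ln (p i) + of_int (k - i) / of_int (j - i) * ln (p j)) \<le> p k"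
    using pos k by (simp add: ln_ge_iff)
  then show ?thesis
    using True by (simp add: powr_def exp_add)
qed

section \<open>Log-concave functions\<close>

text \<open>A vanishing value makes the left side 0, since \<open>0 powr s = 0\<close>, and the
  order of the points is reversed by replacing \<open>l\<close> with \<open>1 - l\<close>.\<close>

lemma log_concave_funI_less:
  fixes f :: "real \<Rightarrow> real"
  assumes nn: "\<And>x. 0 \<le> f x"
    and le: "\<And>x y l. x < y \<Longrightarrow> 0 < l \<Longrightarrow> l < 1 \<Longrightarrow> f x > 0 \<Longrightarrow> f y > 0 \<Longrightarrow>
      f x powr (1 - l) * f y powr l \<le> f ((1 - l) * x + l * y)"
  shows "log_concave_fun f"
  unfolding log_concave_fun_def
proof (intro conjI allI impI)
  fix x y l :: real
  assume l: "0 < l \<and> l < 1"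
  show "f x powr (1 - l) * f y powr l \<le> f ((1 - l) * x + l * y)"
  proof (cases "f x > 0 \<and> f y > 0")
    case False
    then have "f x = 0 \<or> f y = 0" using nn by (metis less_eq_real_def)
    then show ?thesis using nn by auto
  next
    case True
    consider "x < y" | "x = y" | "y < x" by linarith
    then show ?thesis
    proof cases
      case 2
      have "f x powr (1 - l) * f x powr l = f x"
        using True by (simp flip: powr_add)
      with 2 show ?thesis by (simp add: algebra_simps)
    next
      case 3
      then show ?thesis using le[of y x "1 - l"] l True by (simp add: ac_simps)
    qed (use le l True in auto)
  qed
qed (rule nn)

lemma log_concave_funD:
  "log_concave_fun f \<Longrightarrow> 0 < l \<Longrightarrow> l < 1 \<Longrightarrow> f x powr (1 - l) * f y powr l \<le> f ((1 - l) * x + l * y)"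
  by (auto simp: log_concave_fun_def)

text \<open>Only points with positive limit values need checking, and \<open>powr\<close> is
  continuous at a positive base.\<close>

lemma log_concave_fun_limit:
  fixes f :: "real \<Rightarrow> real" and g :: "nat \<Rightarrow> real \<Rightarrow> real"
  assumes g: "\<And>n. log_concave_fun (g n)" and lim: "\<And>x. (\<lambda>n. g n x) \<longlonglongrightarrow> f x"
  shows "log_concave_fun f"
proof (rule log_concave_funI_less)
  show "0 \<le> f x" for x
    using g by (intro LIMSEQ_le_const[OF lim]) (auto simp: log_concave_fun_def)
  fix x y l :: real
  assume "0 < l" "l < 1" "f x > 0" "f y > 0"
  then show "f x powr (1 - l) * f y powr l \<le> f ((1 - l) * x + l * y)"
    using log_concave_funD[OF g]
    by (intro LIMSEQ_le[where X = "\<lambda>n. g n x powr (1 - l) * g n y powr l", OF _ lim]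
          tendsto_mult tendsto_powr lim tendsto_const) auto
qed

lemma log_concave_fun_shift:
  assumes "log_concave_fun f"
  shows "log_concave_fun (\<lambda>x. f (x + d))"
  unfolding log_concave_fun_def
proof (intro conjI allI impI)
  fix x y l :: real
  assume "0 < l \<and> l < 1"
  then show "f (x + d) powr (1 - l) * f (y + d) powr l \<le> f ((1 - l) * x + l * y + d)"
    using log_concave_funD[OF assms, of l "x + d" "y + d"] by (simp add: algebra_simps)
qed (use assms in \<open>auto simp: log_concave_fun_def\<close>)

lemma log_concave_fun_cmult:
  assumes f: "log_concave_fun f" and "c > 0"
  shows "log_concave_fun (\<lambda>x. c * f x)"
  unfolding log_concave_fun_def
proof (intro conjI allI impI)
  fix x y l :: real
  assume l: "0 < l \<and> l < 1"
  have nn: "0 \<le> f x" for x using f by (simp add: log_concave_fun_def)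
  have "(c * f x) powr (1 - l) * (c * f y) powr l = c powr (1 - l) * c powr l * (f x powr (1 - l) * f y powr l)"
    using nn \<open>c > 0\<close> by (simp add: powr_mult)
  also have "c powr (1 - l) * c powr l = c"
    using \<open>c > 0\<close> by (simp flip: powr_add)
  finally show "(c * f x) powr (1 - l) * (c * f y) powr l \<le> c * f ((1 - l) * x + l * y)"
    using log_concave_funD[OF f, of l x y] l \<open>c > 0\<close> by simp
qed (use assms in \<open>auto simp: log_concave_fun_def\<close>)

lemma log_concave_fun_restrict:
  assumes f: "log_concave_fun f" and "convex S"
  shows "log_concave_fun (\<lambda>x. if x \<in> S then f x else 0)"
  unfolding log_concave_fun_def
proof (intro conjI allI impI)
  fix x y l :: real
  assume l: "0 < l \<and> l < 1"
  have nn: "0 \<le> f x" for x using f by (simp add: log_concave_fun_def)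
  have "(1 - l) * x + l * y \<in> S" if "x \<in> S" "y \<in> S"
    using convexD[OF \<open>convex S\<close> that, of "1 - l" l] l by simp
  then show "(if x \<in> S then f x else 0) powr (1 - l) * (if y \<in> S then f y else 0) powr l
      \<le> (if (1 - l) * x + l * y \<in> S then f ((1 - l) * x + l * y) else 0)"
    using log_concave_funD[OF f, of l x y] l nn by auto
qed (use f in \<open>auto simp: log_concave_fun_def\<close>)

lemma log_concave_fun_imp_concave_ln:
  assumes f: "log_concave_fun f" and "convex S" and pos: "\<And>x. x \<in> S \<Longrightarrow> f x > 0"
  shows "concave_on S (\<lambda>x. ln (f x))"
proof
  fix l x y :: real
  assume l: "0 < l" "l < 1" and xy: "x \<in> S" "y \<in> S"
  have z: "(1 - l) * x + l * y \<in> S"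
    using convexD[OF \<open>convex S\<close> xy, of "1 - l" l] l by simp
  have "ln (f x powr (1 - l) * f y powr l) \<le> ln (f ((1 - l) * x + l * y))"
    using log_concave_funD[OF f, of l x y] l pos[OF xy(1)] pos[OF xy(2)] pos[OF z]
    by (simp add: ln_le_cancel_iff)
  then show "(1 - l) * ln (f x) + l * ln (f y) \<le> ln (f ((1 - l) *\<^sub>R x + l *\<^sub>R y))"
    using pos[OF xy(1)] pos[OF xy(2)] by (simp add: ln_mult_pos)
qed fact

text \<open>The convex function \<open>- ln f\<close> is continuous on the open set
  \<open>S\<close>; exponentiating recovers \<open>f\<close>.\<close>

lemma log_concave_fun_continuous_on:
  assumes f: "log_concave_fun f" and S: "convex S" "open S" and pos: "\<And>x. x \<in> S \<Longrightarrow> f x > 0"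
  shows "continuous_on S f"
proof -
  have "continuous_on S (\<lambda>x. - ln (f x))"
    using log_concave_fun_imp_concave_ln[OF f S(1) pos] S(2)
    by (intro convex_on_continuous) (auto simp: concave_on_def)
  then have "continuous_on S (\<lambda>x. exp (- (- ln (f x))))"
    by (rule continuous_on_exp[OF continuous_on_minus])
  then show ?thesis
    by (rule continuous_on_eq) (simp add: pos)
qed

section \<open>Passing from the grid to increments of the distribution function\<close>

context real_distribution
begin

lemma cell_prob_eq_cdf:
  assumes "h > 0"
  shows "cell_prob M h a k = cdf M (a + of_int k * h) - cdf M (a + (of_int k - 1) * h)"
  using assms cdf_diff_eq[of "a + (of_int k - 1) * h" "a + of_int k * h"]
  by (simp add: cell_prob_def cell_def)

lemma sum_cell_prob:
  assumes "h > 0"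
  shows "(\<Sum>t=1..m. cell_prob M h a (i + int t)) = cdf M (a + (of_int i + real m) * h) - cdf M (a + of_int i * h)"
  by (induction m) (simp_all add: cell_prob_eq_cdf[OF assms] algebra_simps)

lemma tendsto_cdf_right:
  assumes "u \<longlonglongrightarrow> x" "\<And>n. x \<le> u n"
  shows "(\<lambda>n. cdf M (u n)) \<longlonglongrightarrow> cdf M x"
proof -
  have "continuous (at x within {x..}) (cdf M)"
    using cdf_is_right_cont[of x] by (simp add: continuous_within at_within_Ici_at_right)
  then show ?thesis
    using assms by (intro continuous_within_tendsto_compose[of x "{x..}" "cdf M"]) auto
qed

text \<open>A window of about \<open>d / h n\<close> cells starting near \<open>u\<close> has mass
  close to \<open>F (u + d) - F u\<close>, where \<open>F\<close> is the distribution function.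
  Window sums are log-concave in the grid index, and the interpolation inequality survives the
  limit.\<close>

lemma log_concave_increments:
  fixes h a :: "nat \<Rightarrow> real"
  assumes h: "\<And>n. 0 < h n" "h \<longlonglongrightarrow> 0"
    and int: "\<And>n. int_interval {k. cell_prob M (h n) (a n) k > 0}"
    and lc: "\<And>n. log_concave_seq (cell_prob M (h n) (a n))"
    and "d > 0"
  shows "log_concave_fun (\<lambda>x. cdf M (x + d) - cdf M x)"
proof (rule log_concave_funI_less)
  show "0 \<le> cdf M (x + d) - cdf M x" for x
    using cdf_nondecreasing[of x "x + d"] \<open>d > 0\<close> by simp
  fix x y l :: real
  assume "x < y" and l: "0 < l" "l < 1"
    and pos: "cdf M (x + d) - cdf M x > 0" "cdf M (y + d) - cdf M y > 0"
  define z where "z = (1 - l) * x + l * y"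
  have z: "x \<le> z" "z \<le> y"
    using \<open>x < y\<close> l mult_left_mono[of x y l] mult_left_mono[of x y "1 - l"]
    by (auto simp: z_def algebra_simps)
  \<comment> \<open>Everything is rounded up: \<open>P u n\<close> approaches \<open>u\<close> from
    the right and \<open>P u n + m n * h n\<close> approaches \<open>u + d\<close> from the right,
    so right continuity of the distribution function suffices.\<close>
  define I where "I u n = \<lceil>(u - a n) / h n\<rceil>" for u n
  define P where "P u n = a n + of_int (I u n) * h n" for u n
  define m where "m n = nat \<lceil>d / h n\<rceil>" for n
  define W where "W i n = cdf M (a n + (of_int i + real (m n)) * h n) - cdf M (a n + of_int i * h n)" for i n
  have P: "u \<le> P u n" "P u n \<le> u + h n" for u n
  proof -
    have "(u - a n) / h n \<le> of_int (I u n)" "of_int (I u n) < (u - a n) / h n + 1"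
      unfolding I_def by linarith+
    then show "u \<le> P u n" "P u n \<le> u + h n"
      unfolding P_def using h(1)[of n] by (auto simp: field_simps)
  qed
  have m: "d \<le> m n * h n" "m n * h n \<le> d + h n" for n
  proof -
    have "0 \<le> \<lceil>d / h n\<rceil>"
      using \<open>d > 0\<close> h(1)[of n] by (smt (verit) divide_nonneg_pos zero_le_ceiling)
    then have "real (m n) = of_int \<lceil>d / h n\<rceil>" unfolding m_def by simp
    moreover have "d / h n \<le> of_int \<lceil>d / h n\<rceil>" "of_int \<lceil>d / h n\<rceil> \<le> d / h n + 1" by linarith+
    ultimately have "d / h n \<le> m n" "m n \<le> (d + h n) / h n"
      using h(1)[of n] by (auto simp: add_divide_distrib)
    then show "d \<le> m n * h n" "m n * h n \<le> d + h n"
      using h(1)[of n] by (simp_all only: pos_divide_le_eq pos_le_divide_eq)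
  qed
  have P_lim: "P u \<longlonglongrightarrow> u" for u
  proof (rule real_tendsto_sandwich[of "\<lambda>_. u" _ _ "\<lambda>n. u + h n"])
    show "(\<lambda>n. u + h n) \<longlonglongrightarrow> u" using tendsto_add[OF tendsto_const h(2), of u] by simp
  qed (use P in auto)
  have m_lim: "(\<lambda>n. m n * h n) \<longlonglongrightarrow> d"
  proof (rule real_tendsto_sandwich[of "\<lambda>_. d" _ _ "\<lambda>n. d + h n"])
    show "(\<lambda>n. d + h n) \<longlonglongrightarrow> d" using tendsto_add[OF tendsto_const h(2), of d] by simp
  qed (use m in auto)
  have W_eq: "W (I u n) n = cdf M (P u n + m n * h n) - cdf M (P u n)" for u n
    by (simp add: W_def P_def algebra_simps)
  have W_lim: "(\<lambda>n. W (I u n) n) \<longlonglongrightarrow> cdf M (u + d) - cdf M u" for u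
    unfolding W_eq using P m
    by (intro tendsto_diff tendsto_cdf_right tendsto_add P_lim m_lim add_mono) auto
  \<comment> \<open>On the grid these ratios are the exponents of the discrete interpolation; for
    \<open>z\<close> between \<open>x\<close> and \<open>y\<close> they tend to \<open>1 - l\<close>
    and \<open>l\<close>.\<close>
  define w where "w u v n = (P v n - P u n) / (P y n - P x n)" for u v n
  have w_lim: "w u v \<longlonglongrightarrow> (v - u) / (y - x)" for u v
    unfolding w_def using \<open>x < y\<close> by (intro tendsto_intros P_lim) auto
  have w_lim': "w z y \<longlonglongrightarrow> 1 - l" "w x z \<longlonglongrightarrow> l"
  proof -
    have "y - z = (1 - l) * (y - x)" "z - x = l * (y - x)"
      by (simp_all add: z_def algebra_simps)
    then show "w z y \<longlonglongrightarrow> 1 - l" "w x z \<longlonglongrightarrow> l"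
      using w_lim[of z y] w_lim[of x z] \<open>x < y\<close> by simp_all
  qed
  \<comment> \<open>The interpolation needs distinct end indices, which holds once the mesh
    separates \<open>x\<close> from \<open>y\<close>.\<close>
  have "eventually (\<lambda>n. P x n < P y n) sequentially"
    using order_tendstoD[OF tendsto_diff[OF P_lim[of y] P_lim[of x]], of 0] \<open>x < y\<close> by simp
  then have ev: "eventually (\<lambda>n. W (I x n) n powr w z y n * W (I y n) n powr w x z n \<le> W (I z n) n) sequentially"
  proof eventually_elim
    case (elim n)
    have w_eq: "w u v n = of_int (I v n - I u n) / of_int (I y n - I x n)" for u v
      unfolding w_def P_def using h(1)[of n] by (simp flip: left_diff_distrib)
    have mono: "I u n \<le> I v n" if "u \<le> v" for u v
      unfolding I_def using that h(1)[of n] by (intro ceiling_mono divide_right_mono) auto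
    have "I x n < I y n"
      using elim h(1)[of n] by (simp add: P_def)
    moreover have "W = (\<lambda>i n. \<Sum>t=1..m n. cell_prob M (h n) (a n) (i + int t))"
      by (intro ext) (simp only: W_def sum_cell_prob[OF h(1)])
    moreover have nn: "0 \<le> cell_prob M (h n) (a n) k" for k
      by (simp add: cell_prob_def)
    ultimately show ?case
      unfolding w_eq
      using log_concave_seq_interpolate[OF log_concave_seq_window_sum[OF lc int nn]
          int_interval_window_sum[OF int nn] sum_nonneg[OF nn] _ mono[OF z(1)] mono[OF z(2)]]
      by simp
  qed
  have "(\<lambda>n. W (I x n) n powr w z y n * W (I y n) n powr w x z n)
      \<longlonglongrightarrow> (cdf M (x + d) - cdf M x) powr (1 - l) * (cdf M (y + d) - cdf M y) powr l"
    using pos by (intro tendsto_mult tendsto_powr W_lim w_lim') auto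
  from tendsto_le[OF _ W_lim this ev]
  show "(cdf M (x + d) - cdf M x) powr (1 - l) * (cdf M (y + d) - cdf M y) powr l
    \<le> cdf M ((1 - l) * x + l * y + d) - cdf M ((1 - l) * x + l * y)"
    by (simp add: z_def)
qed

end

section \<open>Log-concave densities\<close>

text \<open>
  \<open>C\<close> contains the translates \<open>A + b\<close> and \<open>a + B\<close>, which hardly overlap when \<open>a \<in> A\<close> is close to
  \<open>Sup A\<close> and \<open>b \<in> B\<close> is close to \<open>Inf B\<close>.
\<close>
lemma emeasure_lborel_sumset_ge:
  fixes A B C :: "real set"
  assumes A: "A \<in> sets borel" "A \<noteq> {}" "bounded A" and B: "B \<in> sets borel" "B \<noteq> {}" "bounded B"
    and C: "C \<in> sets borel" and sub: "\<And>x y. x \<in> A \<Longrightarrow> y \<in> B \<Longrightarrow> x + y \<in> C"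
  shows "emeasure lborel A + emeasure lborel B \<le> emeasure lborel C"
proof (rule ennreal_le_epsilon)
  fix e :: real assume "0 < e"
  have bdd: "bdd_above A" "bdd_below B"
    using A B by (auto intro: bounded_imp_bdd_above bounded_imp_bdd_below)
  obtain a where a: "a \<in> A" "Sup A - e / 2 < a"
    using less_cSup_iff[OF A(2) bdd(1), of "Sup A - e / 2"] \<open>0 < e\<close> by auto
  obtain b where b: "b \<in> B" "b < Inf B + e / 2"
    using cInf_less_iff[OF B(2) bdd(2), of "Inf B + e / 2"] \<open>0 < e\<close> by auto
  define A' where "A' = (\<lambda>x. x - b) -` A \<inter> space borel"
  define B' where "B' = (\<lambda>y. y - a) -` B \<inter> space borel"
  have shift: "emeasure lborel ((\<lambda>x. x - c) -` S \<inter> space borel) = emeasure lborel S"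
    if "S \<in> sets borel" for c and S :: "real set"
  proof -
    have "emeasure lborel S = emeasure (distr lborel borel ((+) (- c))) S"
      by (simp add: lborel_distr_plus)
    also have "\<dots> = emeasure lborel ((+) (- c) -` S)"
      using that by (subst emeasure_distr) auto
    also have "(+) (- c) = (\<lambda>x. x - c)" by auto
    finally show ?thesis by simp
  qed
  have meas: "A' \<in> sets borel" "B' \<in> sets borel"
    unfolding A'_def B'_def using A(1) B(1) by (intro measurable_sets[of _ borel borel]; simp)+
  have "A' \<union> B' \<subseteq> C"
    using sub a(1) b(1) by (force simp: A'_def B'_def)
  \<comment> \<open>\<open>A'\<close> is \<open>A + b\<close> and \<open>B'\<close> is
    \<open>B + a\<close>. The interval has length \<open>(Sup A - a) + (b - Inf B)\<close>, less
    than \<open>e\<close> by the choice of \<open>a\<close> and \<open>b\<close>.\<close>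
  have "A' \<inter> B' \<subseteq> {Inf B + a .. Sup A + b}"
    using cSup_upper[OF _ bdd(1)] cInf_lower[OF _ bdd(2)] by (force simp: A'_def B'_def)
  then have "emeasure lborel (A' \<inter> B') \<le> emeasure lborel {Inf B + a .. Sup A + b}"
    by (intro emeasure_mono) auto
  also have "\<dots> \<le> e"
    using a b by (auto simp: emeasure_lborel_Icc_eq)
  finally have overlap: "emeasure lborel (A' \<inter> B') \<le> e" .
  have "emeasure lborel A + emeasure lborel B = emeasure lborel A' + emeasure lborel B'"
    unfolding A'_def B'_def using shift A(1) B(1) by simp
  also have "\<dots> = emeasure lborel (A' \<union> B') + emeasure lborel (A' \<inter> B')"
    using meas by (intro emeasure_Un_Int) auto
  also have "\<dots> \<le> emeasure lborel C + e"
    using C \<open>A' \<union> B' \<subseteq> C\<close> overlap by (intro add_mono emeasure_mono) auto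
  finally show "emeasure lborel A + emeasure lborel B \<le> emeasure lborel C + e" .
qed

section \<open>Dilation and the Brunn-Minkowski inequality on the line\<close>

lemma emeasure_lborel_vimage_divide:
  fixes A :: "real set"
  assumes "A \<in> sets borel" "c > 0"
  shows "emeasure lborel ((\<lambda>x. x / c) -` A) = ennreal c * emeasure lborel A"
proof -
  have "emeasure lborel A = emeasure (density (distr lborel borel (\<lambda>x. 0 + (1/c) * x)) (\<lambda>_. ennreal \<bar>1/c\<bar>)) A"
    using lborel_real_affine[of "1/c" 0] assms by simp
  also have "\<dots> = ennreal (1/c) * emeasure lborel ((\<lambda>x. x / c) -` A)"
    using assms by (simp add: emeasure_density nn_integral_cmult_indicator emeasure_distr)
  finally have "ennreal c * emeasure lborel A = ennreal c * ennreal (1/c) * emeasure lborel ((\<lambda>x. x / c) -` A)"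
    by (simp add: mult.assoc)
  also have "ennreal c * ennreal (1/c) = 1"
    using assms by (simp flip: ennreal_mult')
  finally show ?thesis by simp
qed

text \<open>This is the sumset inequality for the dilates of \<open>A\<close> by
  \<open>1 - l\<close> and of \<open>B\<close> by \<open>l\<close>.\<close>

lemma brunn_minkowski_real:
  fixes A B C :: "real set"
  assumes A: "A \<in> sets borel" "A \<noteq> {}" "bounded A" and B: "B \<in> sets borel" "B \<noteq> {}" "bounded B"
    and C: "C \<in> sets borel" and l: "0 < l" "l < 1"
    and sub: "\<And>x y. x \<in> A \<Longrightarrow> y \<in> B \<Longrightarrow> (1 - l) * x + l * y \<in> C"
  shows "ennreal (1 - l) * emeasure lborel A + ennreal l * emeasure lborel B \<le> emeasure lborel C"
proof -
  have meas: "(\<lambda>x. x / c) -` S \<in> sets borel" if "S \<in> sets borel" for c and S :: "real set"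
    using measurable_sets[of "\<lambda>x. x / c" borel borel S] that by simp
  have eq: "(\<lambda>x. x / c) -` S = (\<lambda>x. c * x) ` S" if "c > 0" for c and S :: "real set"
    using that by (force simp: image_iff)
  have meas': "(\<lambda>x. c * x) ` S \<in> sets borel" if "S \<in> sets borel" "c > 0" for c and S :: "real set"
    using meas[OF that(1), of c] eq[OF that(2), of S] by simp
  have bdd: "bounded ((\<lambda>x. c * x) ` S)" if "bounded S" for c and S :: "real set"
    using bounded_scaling[OF that, of c] by simp
  show ?thesis
    using l A B C sub
    by (simp only: flip: emeasure_lborel_vimage_divide)
       (rule emeasure_lborel_sumset_ge, auto simp: meas' eq bdd)
qed

text \<open>Layer-cake: \<open>c \<cdot> |{t \<in> [0,1]. c t < f x}| = min c (f x)\<close>, integrated over \<open>x \<in> X\<close>.\<close>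
lemma nn_integral_superlevel:
  fixes f :: "real \<Rightarrow> real"
  assumes f: "f \<in> borel_measurable borel" and X: "X \<in> sets borel" and "c > 0" and nn: "\<And>x. 0 \<le> f x"
  shows "ennreal c * (\<integral>\<^sup>+t. emeasure lborel {x\<in>X. c * t < f x} * indicator {0..1} t \<partial>lborel)
    = (\<integral>\<^sup>+x. ennreal (min c (f x)) * indicator X x \<partial>lborel)"
proof -
  have [measurable]: "f \<in> borel_measurable borel" "X \<in> sets borel" by fact+
  have "(\<integral>\<^sup>+t. emeasure lborel {x\<in>X. c * t < f x} * indicator {0..1} t \<partial>lborel)
      = (\<integral>\<^sup>+t. (\<integral>\<^sup>+x. indicator X x * indicator {0..1} t * (if c * t < f x then 1 else 0) \<partial>lborel) \<partial>lborel)"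
  proof (rule nn_integral_cong)
    fix t :: real
    have "emeasure lborel {x\<in>X. c * t < f x} * indicator {0..1} t
        = (\<integral>\<^sup>+x. indicator {0..1} t * indicator {x\<in>X. c * t < f x} x \<partial>lborel)"
      by (subst nn_integral_cmult_indicator) (auto simp: mult.commute)
    also have "\<dots> = (\<integral>\<^sup>+x. indicator X x * indicator {0..1} t * (if c * t < f x then 1 else 0) \<partial>lborel)"
      by (intro nn_integral_cong) (auto simp: indicator_def)
    finally show "emeasure lborel {x\<in>X. c * t < f x} * indicator {0..1} t = \<dots>" .
  qed
  also have "\<dots> = (\<integral>\<^sup>+x. (\<integral>\<^sup>+t. indicator X x * indicator {0..1} t * (if c * t < f x then 1 else 0) \<partial>lborel) \<partial>lborel)"
    by (rule lborel_pair.Fubini') measurable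
  also have "\<dots> = (\<integral>\<^sup>+x. indicator X x * ennreal (min 1 (f x / c)) \<partial>lborel)"
  proof (rule nn_integral_cong)
    fix x
    have "(\<integral>\<^sup>+t. indicator X x * indicator {0..1} t * (if c * t < f x then 1 else 0) \<partial>lborel)
       = (\<integral>\<^sup>+t. indicator X x * indicator ({0..1} \<inter> {..<f x / c}) t \<partial>lborel)"
      using \<open>c > 0\<close> by (intro nn_integral_cong) (auto simp: indicator_def field_simps)
    also have "\<dots> = indicator X x * emeasure lborel ({0..1} \<inter> {..<f x / c})"
      by (subst nn_integral_cmult_indicator) auto
    also have "emeasure lborel ({0..1} \<inter> {..<f x / c}) = ennreal (min 1 (f x / c))"
    proof (cases "f x / c \<le> 1")
      case True
      then have "{0..1} \<inter> {..<f x / c} = {0..<f x / c}" by auto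
      then show ?thesis using True nn[of x] \<open>c > 0\<close> by simp
    next
      case False
      then have "{0..1} \<inter> {..<f x / c} = {0..1}" by auto
      then show ?thesis using False by simp
    qed
    finally show "(\<integral>\<^sup>+t. indicator X x * indicator {0..1} t * (if c * t < f x then 1 else 0) \<partial>lborel)
       = indicator X x * ennreal (min 1 (f x / c))" .
  qed
  also have "ennreal c * \<dots> = (\<integral>\<^sup>+x. ennreal c * (indicator X x * ennreal (min 1 (f x / c))) \<partial>lborel)"
    by (rule nn_integral_cmult[symmetric]) measurable
  also have "\<dots> = (\<integral>\<^sup>+x. ennreal (min c (f x)) * indicator X x \<partial>lborel)"
  proof (rule nn_integral_cong)
    fix x
    have "c * min 1 (f x / c) = min c (f x)"
      using \<open>c > 0\<close> by (auto simp: min_def field_simps)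
    then have "ennreal c * ennreal (min 1 (f x / c)) = ennreal (min c (f x))"
      using \<open>c > 0\<close> nn[of x] by (simp flip: ennreal_mult')
    then show "ennreal c * (indicator X x * ennreal (min 1 (f x / c))) = ennreal (min c (f x)) * indicator X x"
      by (metis mult.commute mult.left_commute)
  qed
  finally show ?thesis .
qed

section \<open>The Prekopa-Leindler inequality for a log-concave density\<close>

text \<open>Scaling the levels by the suprema \<alpha> and \<beta> of \<open>f\<close> on
  \<open>A\<close> and \<open>B\<close> makes both superlevel sets nonempty for the same
  \<open>t\<close>, namely \<open>0 < t < 1\<close>. Brunn-Minkowski at each level, integrated over
  \<open>t\<close>, bounds \<open>\<mu> C\<close> below by an arithmetic mean, which dominates the
  geometric mean.\<close>

lemma density_log_concave_bounded_sets:
  fixes f :: "real \<Rightarrow> real" and A B C :: "real set"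
  assumes f[measurable]: "f \<in> borel_measurable borel" and lc: "log_concave_fun f"
    and A: "A \<in> sets borel" "bounded A" and B: "B \<in> sets borel" "bounded B"
    and C[measurable]: "C \<in> sets borel" and l: "0 < l" "l < 1"
    and sub: "\<And>x y. x \<in> A \<Longrightarrow> y \<in> B \<Longrightarrow> (1 - l) * x + l * y \<in> C"
    and bound: "\<And>x. x \<in> A \<union> B \<Longrightarrow> f x \<le> K"
    and fin: "finite_measure (density lborel f)"
  defines "\<mu> \<equiv> measure (density lborel f)"
  shows "\<mu> A powr (1 - l) * \<mu> B powr l \<le> \<mu> C"
proof (cases "\<mu> A > 0 \<and> \<mu> B > 0")
  case False
  then have "\<mu> A = 0 \<or> \<mu> B = 0"
    unfolding \<mu>_def using measure_nonneg by (metis less_eq_real_def)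
  then show ?thesis unfolding \<mu>_def by auto
next
  case True
  have nn: "0 \<le> f x" for x using lc by (simp add: log_concave_fun_def)
  interpret finite_measure "density lborel f" by (rule fin)
  have \<mu>: "ennreal (\<mu> S) = (\<integral>\<^sup>+x. ennreal (f x) * indicator S x \<partial>lborel)" if "S \<in> sets borel" for S
    using that by (simp add: \<mu>_def emeasure_eq_measure[symmetric] emeasure_density)
  \<comment> \<open>The supremum is positive because \<open>f\<close> cannot vanish throughout a set
    of positive mass.\<close>
  have sup: "0 < Sup (f ` S) \<and> (\<forall>x\<in>S. f x \<le> Sup (f ` S)) \<and> (\<forall>t<Sup (f ` S). \<exists>x\<in>S. t < f x)"
    if S: "S \<in> sets borel" "\<mu> S > 0" "S \<subseteq> A \<union> B" for S
  proof -
    have bdd: "bdd_above (f ` S)"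
      using bound S(3) by (intro bdd_aboveI2[of _ _ K]) auto
    have "\<exists>x\<in>S. f x > 0"
    proof (rule ccontr)
      assume "\<not> (\<exists>x\<in>S. f x > 0)"
      then have "f x = 0" if "x \<in> S" for x
        using nn[of x] that by force
      then have "(\<integral>\<^sup>+x. ennreal (f x) * indicator S x \<partial>lborel) = (\<integral>\<^sup>+(x::real). 0 \<partial>lborel)"
        by (intro nn_integral_cong) (auto simp: indicator_def)
      then show False using \<mu>[OF S(1)] S(2) by (simp add: ennreal_eq_0_iff)
    qed
    then obtain x where x: "x \<in> S" "f x > 0" by blast
    then have "f ` S \<noteq> {}" by auto
    moreover have "f y \<le> Sup (f ` S)" if "y \<in> S" for y
      using bdd that by (intro cSup_upper) auto
    ultimately show ?thesis
      using x less_cSup_iff[OF _ bdd] by (smt (verit, ccfv_threshold) image_iff)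
  qed
  define \<alpha> where "\<alpha> = Sup (f ` A)"
  define \<beta> where "\<beta> = Sup (f ` B)"
  define s where "s = \<alpha> powr (1 - l) * \<beta> powr l"
  have \<alpha>: "0 < \<alpha>" "\<And>x. x \<in> A \<Longrightarrow> f x \<le> \<alpha>" "\<And>t. t < \<alpha> \<Longrightarrow> \<exists>x\<in>A. t < f x"
    using sup[of A] True A by (auto simp: \<alpha>_def)
  have \<beta>: "0 < \<beta>" "\<And>x. x \<in> B \<Longrightarrow> f x \<le> \<beta>" "\<And>t. t < \<beta> \<Longrightarrow> \<exists>x\<in>B. t < f x"
    using sup[of B] True B by (auto simp: \<beta>_def)
  have "s > 0" using \<alpha>(1) \<beta>(1) by (simp add: s_def)
  define L where "L c S = (\<integral>\<^sup>+t. emeasure lborel {x\<in>S. c * t < f x} * indicator {0..1} t \<partial>lborel)" for c S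
  have cake: "ennreal c * L c S = (\<integral>\<^sup>+x. ennreal (min c (f x)) * indicator S x \<partial>lborel)"
    if "c > 0" "S \<in> sets borel" for c S
    unfolding L_def using nn_integral_superlevel[OF f that(2,1) nn] .
  have cake_eq: "L c S = ennreal (\<mu> S / c)"
    if "c > 0" "S \<in> sets borel" "\<And>x. x \<in> S \<Longrightarrow> f x \<le> c" for c S
  proof -
    have "ennreal c * L c S = ennreal (\<mu> S)"
      unfolding \<mu>[OF that(2)] cake[OF that(1,2)]
      using that(3) by (intro nn_integral_cong) (auto simp: indicator_def)
    also have "\<dots> = ennreal c * ennreal (\<mu> S / c)"
      using that(1) by (simp flip: ennreal_mult')
    finally show ?thesis
      using that(1) by (simp add: ennreal_mult_cancel_left)
  qed
  have [measurable]: "A \<in> sets borel" "B \<in> sets borel" by fact+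
  have level: "ennreal (1 - l) * emeasure lborel {x\<in>A. \<alpha> * t < f x} + ennreal l * emeasure lborel {x\<in>B. \<beta> * t < f x}
      \<le> emeasure lborel {x\<in>C. s * t < f x}" if t: "0 < t" "t < 1" for t
  proof (rule brunn_minkowski_real[OF _ _ _ _ _ _ _ l])
    have "\<alpha> * t < \<alpha>" "\<beta> * t < \<beta>" using \<alpha>(1) \<beta>(1) t by simp_all
    then show "{x\<in>A. \<alpha> * t < f x} \<noteq> {}" "{x\<in>B. \<beta> * t < f x} \<noteq> {}"
      using \<alpha>(3) \<beta>(3) by blast+
    show "bounded {x\<in>A. \<alpha> * t < f x}" "bounded {x\<in>B. \<beta> * t < f x}"
      using A(2) B(2) by (auto intro: bounded_subset)
    fix x y
    assume xy: "x \<in> {x\<in>A. \<alpha> * t < f x}" "y \<in> {x\<in>B. \<beta> * t < f x}"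
    \<comment> \<open>Since the exponents add up to 1, the weighted geometric mean of the levels
      \<open>\<alpha> * t\<close> and \<open>\<beta> * t\<close> is exactly
      \<open>s * t\<close>.\<close>
    have "t = t powr (1 - l) * t powr l"
      using t by (simp flip: powr_add)
    then have "s * t = (\<alpha> * t) powr (1 - l) * (\<beta> * t) powr l"
      using \<alpha>(1) \<beta>(1) t by (simp add: s_def powr_mult algebra_simps)
    also have "\<dots> < f x powr (1 - l) * f y powr l"
      using xy l mult_pos_pos[OF \<alpha>(1) t(1)] mult_pos_pos[OF \<beta>(1) t(1)]
      by (intro mult_strict_mono powr_less_mono2) auto
    also have "\<dots> \<le> f ((1 - l) * x + l * y)"
      by (rule log_concave_funD[OF lc l])
    finally show "(1 - l) * x + l * y \<in> {x\<in>C. s * t < f x}"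
      using sub xy by simp
  qed measurable
  have "ennreal (1 - l) * L \<alpha> A + ennreal l * L \<beta> B
     = (\<integral>\<^sup>+t. (ennreal (1 - l) * emeasure lborel {x\<in>A. \<alpha> * t < f x} + ennreal l * emeasure lborel {x\<in>B. \<beta> * t < f x})
          * indicator {0..1} t \<partial>lborel)"
    unfolding L_def
    by (simp add: nn_integral_add nn_integral_cmult distrib_right mult.assoc)
  also have "\<dots> \<le> L s C"
    unfolding L_def
  proof (rule nn_integral_mono_AE)
    \<comment> \<open>The levels \<open>t = 0\<close> and \<open>t = 1\<close> are discarded as null
      sets; at \<open>t = 1\<close> the superlevel sets in \<open>A\<close> and \<open>B\<close> are
      empty, so Brunn-Minkowski does not apply.\<close>
    show "AE t in lborel. (ennreal (1 - l) * emeasure lborel {x\<in>A. \<alpha> * t < f x} + ennreal l * emeasure lborel {x\<in>B. \<beta> * t < f x})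
          * indicator {0..1} t \<le> emeasure lborel {x\<in>C. s * t < f x} * indicator {0..1} t"
      using AE_lborel_singleton[of 0] AE_lborel_singleton[of 1]
    proof eventually_elim
      case (elim t)
      then show ?case using level[of t] by (cases "t \<in> {0..1}") auto
    qed
  qed
  finally have "ennreal s * (ennreal (1 - l) * L \<alpha> A + ennreal l * L \<beta> B) \<le> ennreal s * L s C"
    by (rule mult_left_mono) simp
  \<comment> \<open>On \<open>C\<close> the density may exceed \<open>s\<close>, so the layer-cake
    integral of \<open>min s f\<close> gives a lower bound for \<open>\<mu> C\<close>, whereas on
    \<open>A\<close> and \<open>B\<close> it is exact.\<close>
  also have "\<dots> \<le> ennreal (\<mu> C)"
    unfolding cake[OF \<open>s > 0\<close> C] \<mu>[OF C]
    by (intro nn_integral_mono mult_right_mono ennreal_leI) auto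
  also have "ennreal s * (ennreal (1 - l) * L \<alpha> A + ennreal l * L \<beta> B)
      = ennreal (s * ((1 - l) * (\<mu> A / \<alpha>) + l * (\<mu> B / \<beta>)))"
    using cake_eq[OF \<alpha>(1) A(1) \<alpha>(2)] cake_eq[OF \<beta>(1) B(1) \<beta>(2)] l True \<alpha>(1) \<beta>(1) \<open>s > 0\<close>
    by (simp add: ennreal_mult ennreal_plus del: times_divide_eq_right)
  finally have *: "s * ((1 - l) * (\<mu> A / \<alpha>) + l * (\<mu> B / \<beta>)) \<le> \<mu> C"
    by (simp add: \<mu>_def)
  have "\<mu> A powr (1 - l) * \<mu> B powr l = s * ((\<mu> A / \<alpha>) powr (1 - l) * (\<mu> B / \<beta>) powr l)"
    using \<alpha>(1) \<beta>(1) True by (simp add: s_def powr_divide)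
  \<comment> \<open>Weighted arithmetic-geometric mean inequality.\<close>
  also have "\<dots> \<le> s * ((1 - l) * (\<mu> A / \<alpha>) + l * (\<mu> B / \<beta>))"
    using Youngs_inequality_0[of "1 - l" l "\<mu> A / \<alpha>" "\<mu> B / \<beta>"] l True \<alpha>(1) \<beta>(1) \<open>s > 0\<close>
    by (intro mult_left_mono) auto
  also note *
  finally show ?thesis .
qed

section \<open>Log-concavity of measures with a log-concave density and of point masses\<close>

lemma compact_convex_combination:
  fixes A B :: "real set"
  assumes "compact A" "compact B"
  shows "compact {u * x + v * y | x y. x \<in> A \<and> y \<in> B}"
proof -
  have "compact ((\<lambda>(x, y). u * x + v * y) ` (A \<times> B))"
    using assms by (intro compact_continuous_image compact_Times)
      (auto intro!: continuous_intros simp: case_prod_unfold)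
  moreover have "(\<lambda>(x, y). u * x + v * y) ` (A \<times> B) = {u * x + v * y | x y. x \<in> A \<and> y \<in> B}"
    by auto
  ultimately show ?thesis by simp
qed

lemma log_concave_density_imp_measure:
  assumes fin: "finite_measure \<nu>" and dens: "has_log_concave_density \<nu>"
  shows "log_concave_measure \<nu>"
  unfolding log_concave_measure_def
proof (intro allI impI, elim conjE)
  fix A B :: "real set" and l :: real
  assume cpt: "compact A" "compact B" and l: "0 < l" "l < 1"
  from dens obtain f where f[measurable]: "f \<in> borel_measurable borel" and lc: "log_concave_fun f"
    and \<nu>: "\<nu> = density lborel (\<lambda>x. ennreal (f x))"
    by (auto simp: has_log_concave_density_def)
  interpret finite_measure \<nu> by (rule fin)
  let ?C = "{(1 - l) * x + l * y | x y. x \<in> A \<and> y \<in> B}"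
  \<comment> \<open>\<open>f\<close> is not assumed bounded, but the level-set argument normalises by suprema.\<close>
  define T where "T S n = S \<inter> {x. f x \<le> real n}" for S n
  have meas: "S \<in> sets borel" "T S n \<in> sets borel" if "compact S" for S n
  proof -
    show "S \<in> sets borel" using that by (simp add: borel_closed compact_imp_closed)
    then show "T S n \<in> sets borel" unfolding T_def by measurable
  qed
  have lim: "(\<lambda>n. measure \<nu> (T S n)) \<longlonglongrightarrow> measure \<nu> S" if "compact S" for S
  proof -
    have "(\<Union>n. T S n) = S"
      using real_arch_simple by (force simp: T_def)
    moreover have "(\<lambda>n. measure \<nu> (T S n)) \<longlonglongrightarrow> measure \<nu> (\<Union>n. T S n)"
      using meas[OF that] by (intro finite_Lim_measure_incseq) (auto simp: \<nu> incseq_def T_def)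
    ultimately show ?thesis by simp
  qed
  \<comment> \<open>The truncated sets are bounded and Borel but need not be compact. Only they grow
    with \<open>n\<close>; the target set \<open>?C\<close> stays fixed.\<close>
  have step: "measure \<nu> (T A n) powr (1 - l) * measure \<nu> (T B n) powr l \<le> measure \<nu> ?C" for n
    unfolding \<nu>
  proof (rule density_log_concave_bounded_sets[OF f lc _ _ _ _ _ l])
    show "bounded (T A n)" "bounded (T B n)"
      using cpt by (auto simp: T_def intro: bounded_subset compact_imp_bounded)
    show "?C \<in> sets borel"
      using compact_convex_combination[OF cpt] by (simp add: borel_closed compact_imp_closed)
    show "f x \<le> real n" if "x \<in> T A n \<union> T B n" for x
      using that by (auto simp: T_def)
    show "finite_measure (density lborel (\<lambda>x. ennreal (f x)))"
      using fin by (simp add: \<nu>)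
  qed (use meas cpt in \<open>auto simp: T_def\<close>)
  show "measure \<nu> A powr (1 - l) * measure \<nu> B powr l \<le> measure \<nu> ?C"
  proof (cases "measure \<nu> A = 0 \<or> measure \<nu> B = 0")
    case False
    then show ?thesis
      using step by (intro LIMSEQ_le_const2[of "\<lambda>n. measure \<nu> (T A n) powr (1 - l) * measure \<nu> (T B n) powr l"]
          tendsto_mult tendsto_powr tendsto_const lim cpt) auto
  qed auto
qed

text \<open>All masses are 0 or 1, and if the atom \<open>z\<close> lies in both sets it is its own
  convex combination.\<close>

lemma point_mass_imp_log_concave:
  assumes "point_mass \<nu>"
  shows "log_concave_measure \<nu>"
  unfolding log_concave_measure_def
proof (intro allI impI, elim conjE)
  fix A B :: "real set" and l :: real
  assume cpt: "compact A" "compact B" and l: "0 < l" "l < 1"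
  from assms obtain z where \<nu>: "\<nu> = return borel z" by (auto simp: point_mass_def)
  let ?C = "{(1 - l) * x + l * y | x y. x \<in> A \<and> y \<in> B}"
  have meas: "A \<in> sets borel" "B \<in> sets borel" "?C \<in> sets borel"
    using cpt compact_convex_combination[OF cpt] by (simp_all add: borel_closed compact_imp_closed)
  have "z \<in> ?C" if "z \<in> A" "z \<in> B"
    using that by (intro CollectI exI[of _ z]) (auto simp: algebra_simps)
  then show "measure \<nu> A powr (1 - l) * measure \<nu> B powr l \<le> measure \<nu> ?C"
    unfolding \<nu> measure_return[OF meas(1)] measure_return[OF meas(2)] measure_return[OF meas(3)]
    by (auto simp: indicator_def)
qed

section \<open>Cells of a log-concave measure\<close>

context real_distribution
begin

text \<open>Cell \<open>j\<close> contains the convex combination of cells \<open>i\<close> and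
  \<open>k\<close> with weight \<open>l = (j - i) / (k - i)\<close>. Cells are half-open, so the
  defining inequality is applied to compact subintervals exhausting them.\<close>

lemma log_concave_measure_cell_le:
  assumes lc: "log_concave_measure M" and "h > 0" and ik: "i \<le> j" "j \<le> k" "i < k"
  shows "cell_prob M h a i powr (of_int (k - j) / of_int (k - i))
      * cell_prob M h a k powr (of_int (j - i) / of_int (k - i)) \<le> cell_prob M h a j"
proof (cases "j = i \<or> j = k \<or> cell_prob M h a i = 0 \<or> cell_prob M h a k = 0")
  case True
  have "0 \<le> cell_prob M h a t" for t by (simp add: cell_prob_def)
  then show ?thesis using True ik by (auto simp: powr_zero_eq_one)
next
  case False
  define l :: real where "l = of_int (j - i) / of_int (k - i)"
  have l: "0 < l" "l < 1" "1 - l = of_int (k - j) / of_int (k - i)"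
    using ik False by (auto simp: l_def field_simps)
  have mid: "(1 - l) * of_int i + l * of_int k = (of_int j :: real)"
  proof -
    have "l * of_int (k - i) = of_int (j - i)" using ik by (simp add: l_def)
    then show ?thesis by (simp add: algebra_simps)
  qed
  define C where "C t n = {a + (of_int t - 1) * h + 1 / real (Suc n) .. a + of_int t * h}" for t n
  have Un: "(\<Union>n. C t n) = cell h a t" for t
  proof (intro equalityI subsetI)
    fix x assume x: "x \<in> cell h a t"
    then obtain n where "inverse (real (Suc n)) < x - (a + (of_int t - 1) * h)"
      using reals_Archimedean[of "x - (a + (of_int t - 1) * h)"] by (auto simp: cell_def)
    then show "x \<in> (\<Union>n. C t n)"
      using x by (auto simp: C_def cell_def inverse_eq_divide intro!: exI[of _ n])
  next
    fix x assume "x \<in> (\<Union>n. C t n)"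
    then obtain n where "x \<in> C t n" by blast
    moreover have "1 / real (Suc n) > 0" by simp
    ultimately show "x \<in> cell h a t"
      unfolding C_def cell_def atLeastAtMost_iff greaterThanAtMost_iff by linarith
  qed
  have lim: "(\<lambda>n. measure M (C t n)) \<longlonglongrightarrow> cell_prob M h a t" for t
  proof -
    have "(\<lambda>n. measure M (C t n)) \<longlonglongrightarrow> measure M (\<Union>n. C t n)"
    proof (rule finite_Lim_measure_incseq)
      have "1 / real (Suc n) \<le> 1 / real (Suc m)" if "m \<le> n" for m n
        using that by (intro divide_left_mono) auto
      then show "incseq (C t)" unfolding C_def incseq_def by (force simp del: of_nat_Suc)
    qed (auto simp: C_def)
    then show ?thesis by (simp add: Un cell_prob_def)
  qed
  have step: "measure M (C i n) powr (1 - l) * measure M (C k n) powr l \<le> cell_prob M h a j" for n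
  proof -
    have "measure M (C i n) powr (1 - l) * measure M (C k n) powr l
        \<le> measure M {(1 - l) * x + l * y | x y. x \<in> C i n \<and> y \<in> C k n}"
      using lc[unfolded log_concave_measure_def, rule_format, of "C i n" "C k n" l] l(1,2)
      by (simp add: C_def)
    also have "\<dots> \<le> cell_prob M h a j"
      unfolding cell_prob_def
    proof (rule finite_measure_mono)
      show "{(1 - l) * x + l * y | x y. x \<in> C i n \<and> y \<in> C k n} \<subseteq> cell h a j"
      proof safe
        fix x y assume xy: "x \<in> C i n" "y \<in> C k n"
        define e where "e = 1 / real (Suc n)"
        have e: "e > 0" by (simp add: e_def)
        have C: "C t n = {a + (of_int t - 1) * h + e .. a + of_int t * h}" for t
          by (simp add: C_def e_def)
        \<comment> \<open>By \<open>mid\<close> the endpoints combine to those of cell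
          \<open>j\<close>; the margin \<open>e > 0\<close> gives strictness at its open left
          end.\<close>
        have "(1 - l) * (a + (of_int i - 1) * h + e) + l * (a + (of_int k - 1) * h + e) \<le> (1 - l) * x + l * y"
          using xy l unfolding C by (intro add_mono mult_left_mono) auto
        moreover have "(1 - l) * (a + (of_int i - 1) * h + e) + l * (a + (of_int k - 1) * h + e)
          = a + ((1 - l) * of_int i + l * of_int k - 1) * h + e"
          by (simp add: algebra_simps)
        moreover have "(1 - l) * x + l * y \<le> (1 - l) * (a + of_int i * h) + l * (a + of_int k * h)"
          using xy l unfolding C by (intro add_mono mult_left_mono) auto
        moreover have "(1 - l) * (a + of_int i * h) + l * (a + of_int k * h) = a + ((1 - l) * of_int i + l * of_int k) * h"
          by (simp add: algebra_simps)
        ultimately show "(1 - l) * x + l * y \<in> cell h a j"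
          using e unfolding cell_def mid by simp
      qed
    qed (simp add: cell_def)
    finally show ?thesis .
  qed
  have "cell_prob M h a i powr (1 - l) * cell_prob M h a k powr l \<le> cell_prob M h a j"
    using step False
    by (intro LIMSEQ_le_const2[of "\<lambda>n. measure M (C i n) powr (1 - l) * measure M (C k n) powr l"]
          tendsto_mult tendsto_powr tendsto_const lim) auto
  then show ?thesis unfolding l(3) by (simp add: l_def)
qed

text \<open>The weights 1/2 at \<open>k\<close> between its neighbours give the three-term
  inequality; general weights carry positivity to every index between two support points.\<close>

lemma log_concave_measure_cells:
  assumes lc: "log_concave_measure M" and "h > 0"
  shows "log_concave_seq (cell_prob M h a)" "int_interval {k. cell_prob M h a k > 0}"
proof -
  note le = log_concave_measure_cell_le[OF assms, where a = a]
  have nn: "0 \<le> cell_prob M h a t" for t by (simp add: cell_prob_def)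
  show "log_concave_seq (cell_prob M h a)"
    unfolding log_concave_seq_def
  proof
    fix k
    have "sqrt (cell_prob M h a (k - 1)) * sqrt (cell_prob M h a (k + 1)) \<le> cell_prob M h a k"
      using le[of "k - 1" k "k + 1"] nn by (simp add: powr_half_sqrt)
    then have "sqrt (cell_prob M h a (k - 1) * cell_prob M h a (k + 1)) \<le> cell_prob M h a k"
      by (simp add: real_sqrt_mult)
    then show "cell_prob M h a (k - 1) * cell_prob M h a (k + 1) \<le> (cell_prob M h a k)\<^sup>2"
      by (rule sqrt_le_D)
  qed
  show "int_interval {k. cell_prob M h a k > 0}"
    unfolding int_interval_def mem_Collect_eq
  proof (intro ballI allI impI, unfold mem_Collect_eq)
    fix i k j
    assume pos: "cell_prob M h a i > 0" "cell_prob M h a k > 0" and ij: "i \<le> j \<and> j \<le> k"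
    show "cell_prob M h a j > 0"
    proof (cases "i < k")
      case True
      have "0 < cell_prob M h a i powr (of_int (k - j) / of_int (k - i))
          * cell_prob M h a k powr (of_int (j - i) / of_int (k - i))"
        using pos by simp
      then show ?thesis using le[of i j k] ij True by linarith
    next
      case False
      then have "i = j" using ij by simp
      then show ?thesis using pos by simp
    qed
  qed
qed

end

section \<open>The density of a measure with log-concave increments\<close>

text \<open>Concavity of \<open>ln F\<close> on \<open>{w..}\<close> makes its difference quotient
  \<open>q x d\<close> grow as \<open>d\<close> shrinks, while the secant slope \<open>S\<close>
  from \<open>w\<close> to \<open>a\<close> bounds it. The point \<open>w\<close> strictly left of
  \<open>a\<close> is what makes the bound finite. Exponential estimates transfer both facts to
  \<open>F\<close>.\<close>

lemma log_concave_mono_difference_quotient: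
  fixes F :: "real \<Rightarrow> real"
  assumes lc: "log_concave_fun F" and "mono F" and le1: "\<And>x. F x \<le> 1" and w: "F w > 0" "w < a"
  shows "\<exists>K. \<forall>x\<ge>a. \<forall>n. real (Suc n) * (F (x + 1 / real (Suc n)) - F x) \<le> K"
    and "a \<le> x \<Longrightarrow> convergent (\<lambda>n. real (Suc n) * (F (x + 1 / real (Suc n)) - F x))"
proof -
  have pos: "F x > 0" if "w \<le> x" for x
    using w(1) monoD[OF \<open>mono F\<close> that] by linarith
  define g where "g x = ln (F x)" for x
  define q where "q x d = (g (x + d) - g x) / d" for x d
  define S where "S = (g a - g w) / (a - w)"
  have "concave_on {w..} g"
    unfolding g_def using lc pos by (intro log_concave_fun_imp_concave_ln) auto
  then have cvx: "convex_on {w..} (\<lambda>x. - g x)" by (simp add: concave_on_def)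
  have g_mono: "g x \<le> g y" if "w \<le> x" "x \<le> y" for x y
    using pos[of x] pos[of y] that monoD[OF \<open>mono F\<close> that(2)] by (simp add: g_def)
  have slope1: "(g z - g x) / (z - x) \<le> (g y - g x) / (y - x)"
    and slope2: "(g z - g y) / (z - y) \<le> (g z - g x) / (z - x)" if "w \<le> x" "x < y" "y < z" for x y z
    using convex_on_slope_le[OF cvx, of x z y] that
    by (simp_all add: field_simps)
  have q_nonneg: "0 \<le> q x d" if "w \<le> x" "d > 0" for x d
    using g_mono[of x "x + d"] that by (simp add: q_def)
  have q_le: "q x d \<le> S" if "a \<le> x" "d > 0" for x d
  proof -
    have "q x d \<le> (g (x + d) - g w) / (x + d - w)"
      using slope2[of w x "x + d"] that w by (simp add: q_def)
    also have "\<dots> \<le> S"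
      using slope1[of w a "x + d"] that w by (simp add: S_def)
    finally show ?thesis .
  qed
  have q_anti: "q x d \<le> q x d'" if "w \<le> x" "0 < d'" "d' \<le> d" for x d d'
    using slope1[of x "x + d'" "x + d"] that by (cases "d' = d") (auto simp: q_def)
  have F_eq: "F (x + d) - F x = F x * (exp (d * q x d) - 1)" if "w \<le> x" "d > 0" for x d
  proof -
    have "d * q x d = ln (F (x + d)) - ln (F x)" using that by (simp add: q_def g_def)
    then show ?thesis
      using pos[of x] pos[of "x + d"] that by (simp add: exp_diff right_diff_distrib)
  qed
  have exp_le: "exp u - 1 \<le> u * exp u" for u :: real
  proof -
    have "1 - u \<le> exp (- u)" using exp_ge_add_one_self[of "- u"] by simp
    then have "(1 - u) * exp u \<le> exp (- u) * exp u" by (intro mult_right_mono) auto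
    then show ?thesis by (simp add: algebra_simps flip: exp_add)
  qed
  define N where "N n = real (Suc n)" for n
  have N: "N n > 0" "1 \<le> N n" for n by (simp_all add: N_def)
  \<comment> \<open>With \<open>u = q x (1 / N n)\<close>, multiplying the middle expression of
    \<open>upper\<close> and \<open>lower\<close> by \<open>F x\<close> gives the scaled increment
    of \<open>F\<close>. The upper bound yields \<open>K\<close>, and both bounds together yield the
    limit.\<close>
  have upper: "N n * (exp (1 / N n * u) - 1) \<le> u * exp (u / N n)" for n u
    using mult_left_mono[OF exp_le[of "u / N n"], of "N n"] N[of n] by simp
  have lower: "u \<le> N n * (exp (1 / N n * u) - 1)" for n u
    using mult_left_mono[OF exp_ge_add_one_self[of "u / N n"], of "N n"] N[of n]
    by (simp add: algebra_simps)
  have "N n * (F (x + 1 / N n) - F x) \<le> S * exp S" if "a \<le> x" for x n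
  proof -
    let ?q = "q x (1 / N n)"
    have q: "0 \<le> ?q" "?q \<le> S"
      using q_nonneg[of x "1 / N n"] q_le[of x "1 / N n"] that w N[of n] by auto
    have "?q / N n \<le> ?q / 1"
      using N[of n] q by (intro divide_left_mono) auto
    then have "?q / N n \<le> S" using q by simp
    have "N n * (F (x + 1 / N n) - F x) = F x * (N n * (exp (1 / N n * ?q) - 1))"
      using F_eq[of x "1 / N n"] that w N[of n] by simp
    also have "\<dots> \<le> 1 * (?q * exp (?q / N n))"
      using upper[of n ?q] lower[of ?q n] q le1[of x] pos[of x] that w
      by (intro mult_mono[of "F x" 1]) auto
    also have "\<dots> \<le> S * exp S"
      using q \<open>?q / N n \<le> S\<close> by (simp add: mult_mono)
    finally show ?thesis .
  qed
  then show "\<exists>K. \<forall>x\<ge>a. \<forall>n. real (Suc n) * (F (x + 1 / real (Suc n)) - F x) \<le> K"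
    by (auto simp: N_def)
  assume "a \<le> x"
  have "incseq (\<lambda>n. q x (1 / N n))"
    using \<open>a \<le> x\<close> w by (intro incseq_SucI q_anti) (auto simp: N_def frac_le)
  moreover have "q x (1 / N n) \<le> S" for n using q_le \<open>a \<le> x\<close> N by simp
  ultimately obtain s where s: "(\<lambda>n. q x (1 / N n)) \<longlonglongrightarrow> s"
    using incseq_convergent[of _ S] by blast
  have "(\<lambda>n. 1 / N n) \<longlonglongrightarrow> 0"
    unfolding N_def using LIMSEQ_inverse_real_of_nat by (simp add: inverse_eq_divide)
  then have "(\<lambda>n. q x (1 / N n) * exp (q x (1 / N n) * (1 / N n))) \<longlonglongrightarrow> s * exp (s * 0)"
    by (intro tendsto_intros s)
  then have up: "(\<lambda>n. q x (1 / N n) * exp (q x (1 / N n) / N n)) \<longlonglongrightarrow> s" by simp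
  have "(\<lambda>n. N n * (exp (1 / N n * q x (1 / N n)) - 1)) \<longlonglongrightarrow> s"
    by (rule real_tendsto_sandwich[OF _ _ s up]) (use lower upper in auto)
  then have "(\<lambda>n. F x * (N n * (exp (1 / N n * q x (1 / N n)) - 1))) \<longlonglongrightarrow> F x * s"
    by (intro tendsto_intros)
  moreover have "F x * (N n * (exp (1 / N n * q x (1 / N n)) - 1)) = N n * (F (x + 1 / N n) - F x)" for n
    using F_eq[of x "1 / N n"] \<open>a \<le> x\<close> w N[of n] by simp
  ultimately have "(\<lambda>n. N n * (F (x + 1 / N n) - F x)) \<longlonglongrightarrow> F x * s" by (simp only:)
  then show "convergent (\<lambda>n. real (Suc n) * (F (x + 1 / real (Suc n)) - F x))"
    unfolding N_def by (rule convergentI)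
qed

text \<open>By translation the integral collapses to the average of \<open>F\<close> just right of
  \<open>b\<close> minus that just right of \<open>a\<close>; these are difference quotients of the
  antiderivative \<Phi>.\<close>

lemma integral_difference_quotient_tendsto:
  fixes F :: "real \<Rightarrow> real"
  assumes cont: "continuous_on UNIV F" and "a \<le> b"
  shows "(\<lambda>n. integral {a..b} (\<lambda>x. real (Suc n) * (F (x + 1 / real (Suc n)) - F x))) \<longlonglongrightarrow> F b - F a"
proof -
  define d where "d n = 1 / real (Suc n)" for n
  have d: "d n > 0" "d n \<le> 1" for n by (simp_all add: d_def)
  have d_lim: "d \<longlonglongrightarrow> 0"
    unfolding d_def using LIMSEQ_inverse_real_of_nat by (simp add: inverse_eq_divide)
  define \<Phi> where "\<Phi> x = integral {a..x} F" for x
  have cont': "continuous_on S F" for S using cont continuous_on_subset by blast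
  then have int: "F integrable_on {u..v}" for u v by (intro integrable_continuous_real)
  have quot: "(\<lambda>n. (\<Phi> (t + d n) - \<Phi> t) / d n) \<longlonglongrightarrow> F t" if "a \<le> t" "t \<le> b" for t
  proof -
    \<comment> \<open>The interval reaches to \<open>b + 1\<close> so that \<open>t + d n\<close>
      stays inside, as \<open>d n \<le> 1\<close>.\<close>
    have "(\<Phi> has_real_derivative F t) (at t within {a..b + 1})"
      unfolding \<Phi>_def using that by (intro integral_has_real_derivative cont') auto
    then have "((\<lambda>y. (\<Phi> y - \<Phi> t) / (y - t)) \<longlongrightarrow> F t) (at t within {a..b + 1})"
      by (simp add: has_field_derivative_iff)
    moreover have "filterlim (\<lambda>n. t + d n) (at t within {a..b + 1}) sequentially"
      unfolding filterlim_at using d that tendsto_add[OF tendsto_const d_lim, of t]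
      by (auto intro!: always_eventually add_mono simp: less_imp_neq[symmetric] add_increasing2 less_imp_le)
    ultimately show ?thesis
      using filterlim_compose by fastforce
  qed
  have "integral {a..b} (\<lambda>x. real (Suc n) * (F (x + 1 / real (Suc n)) - F x))
      = (\<Phi> (b + d n) - \<Phi> b) / d n - (\<Phi> (a + d n) - \<Phi> a) / d n" for n
  proof -
    have "integral {a..b} (\<lambda>x. F (x + d n)) = integral {a + d n..b + d n} F"
      using integral_shift_Icc_real[of a b F "d n"] by (simp add: o_def add.commute)
    moreover have "integral {a..a + d n} F + integral {a + d n..b + d n} F = integral {a..b + d n} F"
      using d[of n] \<open>a \<le> b\<close> int by (intro Henstock_Kurzweil_Integration.integral_combine) auto
    moreover have "(\<lambda>x. F (x + d n)) integrable_on {a..b}"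
      by (intro integrable_continuous_real continuous_on_compose2[OF cont] continuous_intros) auto
    ultimately have "integral {a..b} (\<lambda>x. (1 / d n) * (F (x + d n) - F x))
        = (1 / d n) * (\<Phi> (b + d n) - \<Phi> (a + d n) - \<Phi> b)"
      using int by (simp add: Henstock_Kurzweil_Integration.integral_diff \<Phi>_def)
    then show ?thesis by (simp add: \<Phi>_def d_def algebra_simps)
  qed
  then show ?thesis
    using tendsto_diff[OF quot quot, of b a] \<open>a \<le> b\<close> by simp
qed

section \<open>Continuity of the distribution function and construction of the density\<close>

context real_distribution
begin

lemma cdf_tendsto_shift_at_top: "(\<lambda>n. cdf M (x + real (Suc n))) \<longlonglongrightarrow> 1"
  by (rule filterlim_compose[OF cdf_lim_at_top_prob])
     (intro filterlim_tendsto_add_at_top[OF tendsto_const]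
        filterlim_compose[OF filterlim_real_sequentially filterlim_Suc])

lemma cdf_tendsto_shift_at_bot: "(\<lambda>n. cdf M (x - real (Suc n))) \<longlonglongrightarrow> 0"
proof (rule filterlim_compose[OF cdf_lim_at_bot])
  show "filterlim (\<lambda>n. x - real (Suc n)) at_bot sequentially"
    unfolding filterlim_uminus_at_bot
    using filterlim_tendsto_add_at_top[OF tendsto_const
        filterlim_compose[OF filterlim_real_sequentially filterlim_Suc], of "- x"]
    by simp
qed

lemma cdf_log_concave:
  assumes inc: "\<And>d. d > 0 \<Longrightarrow> log_concave_fun (\<lambda>x. cdf M (x + d) - cdf M x)"
  shows "log_concave_fun (cdf M)" "log_concave_fun (\<lambda>x. 1 - cdf M x)"
proof -
  show "log_concave_fun (cdf M)"
  proof (rule log_concave_fun_limit)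
    show "log_concave_fun (\<lambda>x. cdf M x - cdf M (x - real (Suc n)))" for n
      using log_concave_fun_shift[OF inc, of "real (Suc n)" "- real (Suc n)"]
      by (simp del: of_nat_Suc)
    show "(\<lambda>n. cdf M x - cdf M (x - real (Suc n))) \<longlonglongrightarrow> cdf M x" for x
      using tendsto_diff[OF tendsto_const cdf_tendsto_shift_at_bot] by simp
  qed
  show "log_concave_fun (\<lambda>x. 1 - cdf M x)"
  proof (rule log_concave_fun_limit)
    show "log_concave_fun (\<lambda>x. cdf M (x + real (Suc n)) - cdf M x)" for n
      by (rule inc) simp
    show "(\<lambda>n. cdf M (x + real (Suc n)) - cdf M x) \<longlonglongrightarrow> 1 - cdf M x" for x
      by (rule tendsto_diff[OF cdf_tendsto_shift_at_top tendsto_const])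
  qed
qed

text \<open>Positive log-concave functions are continuous on open half-lines. This handles
  \<open>x\<close> if \<open>cdf M\<close> is positive somewhere to its left, or, through
  \<open>1 - cdf M\<close>, if it is below 1 somewhere to its right. Otherwise it jumps from 0 to 1
  at \<open>x\<close>.\<close>

lemma cdf_continuous_or_point_mass:
  assumes lc: "log_concave_fun (cdf M)" "log_concave_fun (\<lambda>x. 1 - cdf M x)"
  shows "continuous_on UNIV (cdf M) \<or> point_mass M"
proof (rule disjCI)
  assume not_pm: "\<not> point_mass M"
  have "isCont (cdf M) x" for x
  proof -
    consider w where "w < x" "cdf M w > 0" | w where "x < w" "cdf M w < 1"
      | "\<And>w. w < x \<Longrightarrow> cdf M w = 0" "\<And>w. x < w \<Longrightarrow> cdf M w = 1"
      using cdf_nonneg cdf_bounded_prob by (metis less_eq_real_def)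
    then show ?thesis
    proof cases
      case 1
      have "continuous_on {w<..} (cdf M)"
        using cdf_nondecreasing[of w] 1(2)
        by (intro log_concave_fun_continuous_on[OF lc(1)]) (auto intro: less_le_trans)
      then show ?thesis using 1(1) by (simp add: continuous_on_eq_continuous_at)
    next
      case 2
      have "continuous_on {..<w} (\<lambda>x. 1 - cdf M x)"
        using cdf_nondecreasing[OF less_imp_le, of _ w] 2(2)
        by (intro log_concave_fun_continuous_on[OF lc(2)]) (auto intro: le_less_trans)
      then have "continuous_on {..<w} (\<lambda>x. 1 - (1 - cdf M x))"
        by (rule continuous_on_diff[OF continuous_on_const])
      then show ?thesis using 2(1) by (simp add: continuous_on_eq_continuous_at)
    next
      case 3
      have "(\<lambda>n. cdf M (x + 1 / real (Suc n))) \<longlonglongrightarrow> cdf M x"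
      proof (rule tendsto_cdf_right)
        have "(\<lambda>n. 1 / real (Suc n)) \<longlonglongrightarrow> 0"
          using LIMSEQ_inverse_real_of_nat by (simp add: inverse_eq_divide)
        from tendsto_add[OF tendsto_const this, of x]
        show "(\<lambda>n. x + 1 / real (Suc n)) \<longlonglongrightarrow> x" by simp
      qed simp
      moreover have "cdf M (x + 1 / real (Suc n)) = 1" for n by (rule 3(2)) simp
      ultimately have "cdf M x = 1" by (simp add: LIMSEQ_const_iff)
      have "M = return borel x"
      proof (rule cdf_unique[OF real_distribution_axioms])
        interpret R: prob_space "return borel x" by (rule prob_space_return) simp
        show "real_distribution (return borel x)" by standard simp
        show "cdf M = cdf (return borel x)"
        proof
          fix y
          show "cdf M y = cdf (return borel x) y"
            using 3 \<open>cdf M x = 1\<close> by (cases y x rule: linorder_cases)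
              (auto simp: cdf_def2[of "return borel x"] measure_return)
        qed
      qed
      then show ?thesis using not_pm by (auto simp: point_mass_def)
    qed
  qed
  then show "continuous_on UNIV (cdf M)" by (simp add: continuous_on_eq_continuous_at)
qed

text \<open>The intermediate value theorem, started at a point where \<open>cdf M\<close> is below
  \<open>e\<close> because it tends to 0 at minus infinity.\<close>

lemma cdf_eq_below:
  assumes cont: "continuous_on UNIV (cdf M)" and e: "0 < e" "e < cdf M b"
  obtains a where "a < b" "cdf M a = e"
proof -
  have "eventually (\<lambda>x. cdf M x < e) at_bot"
    using cdf_lim_at_bot e by (intro order_tendstoD) auto
  then obtain c where c: "cdf M c < e" by (auto simp: eventually_at_bot_linorder)
  then have "c \<le> b" using e cdf_nondecreasing[of b c] by linarith
  then obtain a where "a \<le> b" "cdf M a = e"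
    using IVT'[of "cdf M" c e b] c e continuous_on_subset[OF cont] by fastforce
  moreover from this have "a \<noteq> b" using e by auto
  ultimately show ?thesis using that[of a] by simp
qed

text \<open>The candidate \<open>f\<close> is the right derivative of \<open>cdf M\<close>. Its
  density measure \<open>D\<close> is shown to have the same distribution function, first on
  intervals bounded away from the zeros of \<open>cdf M\<close>, then on half-lines.\<close>

lemma has_log_concave_density_if_increments:
  assumes cont: "continuous_on UNIV (cdf M)"
    and inc: "\<And>d. d > 0 \<Longrightarrow> log_concave_fun (\<lambda>x. cdf M (x + d) - cdf M x)"
  shows "has_log_concave_density M"
proof -
  let ?F = "cdf M"
  note lcF = cdf_log_concave(1)[OF inc]
  have "mono ?F" using cdf_nondecreasing by (auto simp: mono_def)
  define U where "U = {x. ?F x > 0}"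
  define G where "G n x = real (Suc n) * (?F (x + 1 / real (Suc n)) - ?F x)" for n x
  \<comment> \<open>Outside \<open>U\<close> convergence of the quotients is not established, so
    \<open>f\<close> is set to 0 there. The cut-off keeps log-concavity because \<open>U\<close> is
    closed upwards, hence convex.\<close>
  define f where "f x = (if x \<in> U then lim (\<lambda>n. G n x) else 0)" for x
  have G_nonneg: "0 \<le> G n x" for n x
    using cdf_nondecreasing[of x "x + 1 / real (Suc n)"] by (simp add: G_def)
  have U_up: "y \<in> U" if "x \<in> U" "x \<le> y" for x y
    using that cdf_nondecreasing[of x y] by (simp add: U_def)
  have "is_interval U" unfolding is_interval_1 by (blast intro: U_up)
  then have "convex U" by (rule is_interval_convex_1[THEN iffD1])
  have cont': "continuous_on S ?F" for S using cont continuous_on_subset by blast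
  have contG: "continuous_on S (G n)" for S n
    unfolding G_def by (intro continuous_intros continuous_on_compose2[OF cont] cont') auto
  \<comment> \<open>Continuity supplies the point strictly to the left that the quotient lemma
    requires.\<close>
  have below: "\<exists>w<x. ?F w > 0" if "x \<in> U" for x
  proof -
    have "0 < ?F x / 2" "?F x / 2 < ?F x" using that by (simp_all add: U_def)
    then obtain w where "w < x" "?F w = ?F x / 2" by (rule cdf_eq_below[OF cont])
    then show ?thesis using that by (auto simp: U_def)
  qed
  have G_lim: "(\<lambda>n. G n x) \<longlonglongrightarrow> f x" if "x \<in> U" for x
  proof -
    from below[OF that] obtain w where w: "w < x" "?F w > 0" by blast
    have "convergent (\<lambda>n. G n x)"
      unfolding G_def
      by (rule log_concave_mono_difference_quotient(2)[OF lcF \<open>mono ?F\<close> cdf_bounded_prob w(2,1)]) auto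
    then show ?thesis using that by (simp add: f_def convergent_LIMSEQ_iff)
  qed
  then have f_lim: "(\<lambda>n. if x \<in> U then G n x else 0) \<longlonglongrightarrow> f x" for x
    by (cases "x \<in> U") (auto simp: f_def)
  have f_lc: "log_concave_fun f"
  proof (rule log_concave_fun_limit[OF _ f_lim])
    show "log_concave_fun (\<lambda>x. if x \<in> U then G n x else 0)" for n
      unfolding G_def
      by (rule log_concave_fun_restrict[OF log_concave_fun_cmult[OF inc] \<open>convex U\<close>]) auto
  qed
  then have f_nonneg: "0 \<le> f x" for x by (simp add: log_concave_fun_def)
  have F_meas[measurable]: "?F \<in> borel_measurable borel"
    using cont by (rule borel_measurable_continuous_onI)
  have U_meas: "U \<in> sets borel" unfolding U_def by measurable
  have f_meas[measurable]: "f \<in> borel_measurable borel"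
  proof (rule borel_measurable_LIMSEQ_real[OF f_lim])
    show "(\<lambda>x. if x \<in> U then G n x else 0) \<in> borel_measurable borel" for n
      unfolding U_def G_def by measurable
  qed
  define D where "D = density lborel (\<lambda>x. ennreal (f x))"
  have sets_D[simp]: "sets D = sets borel" by (simp add: D_def)
  have emD: "emeasure D S = (\<integral>\<^sup>+x. ennreal (f x) * indicator S x \<partial>lborel)" if "S \<in> sets borel" for S
    unfolding D_def using that by (subst emeasure_density) auto
  \<comment> \<open>The constant \<open>K\<close> dominates the quotients on \<open>{a..b}\<close>,
    so their integrals tend both to that of \<open>f\<close> and to the increment of
    \<open>cdf M\<close>.\<close>
  have D_Icc: "emeasure D {a..b} = ennreal (?F b - ?F a)" if "a \<le> b" "?F a > 0" for a b
  proof -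
    from that have "a \<in> U" by (simp add: U_def)
    from below[OF this] obtain w where w: "w < a" "?F w > 0" by blast
    obtain K where K: "\<And>x n. a \<le> x \<Longrightarrow> G n x \<le> K"
      using log_concave_mono_difference_quotient(1)[OF lcF \<open>mono ?F\<close> cdf_bounded_prob w(2,1)]
      by (auto simp: G_def)
    have inU: "x \<in> U" if "x \<in> {a..b}" for x
      using that \<open>?F a > 0\<close> cdf_nondecreasing[of a x] by (auto simp: U_def)
    have G_int: "G n integrable_on {a..b}" for n by (intro integrable_continuous_real contG)
    have G_le: "norm (G n x) \<le> K" if "x \<in> {a..b}" for n x
      unfolding real_norm_def abs_of_nonneg[OF G_nonneg] using that by (intro K) simp
    note dct = dominated_convergence[of G, OF G_int integrable_const_ivl G_le G_lim[OF inU]]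
    have "integral {a..b} f = ?F b - ?F a"
      using LIMSEQ_unique[OF dct(2) integral_difference_quotient_tendsto[OF cont that(1), folded G_def]] .
    then have "(f has_integral (?F b - ?F a)) {a..b}"
      using integrable_integral[OF dct(1)] by simp
    then show ?thesis
      using nn_integral_has_integral_lebesgue'[of "{a..b}" f] f_nonneg by (simp add: emD)
  qed
  have D_Iic: "emeasure D {..b} = ennreal (?F b)" for b
  proof (rule antisym)
    \<comment> \<open>Near the left end of \<open>U\<close> there is no uniform bound, so
      \<open>{..b}\<close> is exhausted up to points where \<open>f = 0\<close>; a nonempty
      \<open>S n\<close> fits into some \<open>{a..b}\<close> with
      \<open>?F a = 1 / real (Suc n)\<close>.\<close>
    define S where "S n = {x. x \<le> b \<and> 1 / real (Suc n) < ?F x}" for n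
    have S_meas[measurable]: "S n \<in> sets borel" for n unfolding S_def by measurable
    have "(\<Union>n. S n) = {..b} \<inter> U"
    proof (intro equalityI subsetI)
      fix x assume x: "x \<in> {..b} \<inter> U"
      then obtain n where "inverse (real (Suc n)) < ?F x"
        using reals_Archimedean[of "?F x"] by (auto simp: U_def)
      then show "x \<in> (\<Union>n. S n)"
        using x by (auto simp: S_def inverse_eq_divide)
    next
      fix x assume "x \<in> (\<Union>n. S n)"
      then obtain n where "x \<le> b" "1 / real (Suc n) < ?F x" by (auto simp: S_def)
      moreover have "0 < 1 / real (Suc n)" by simp
      ultimately show "x \<in> {..b} \<inter> U"
        unfolding U_def Int_iff mem_Collect_eq atMost_iff by linarith
    qed
    then have "emeasure D {..b} = emeasure D (\<Union>n. S n)"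
      by (subst (1 2) emD) (auto intro!: nn_integral_cong sets.Int U_meas simp: indicator_def f_def)
    also have "\<dots> = (SUP n. emeasure D (S n))"
    proof (rule SUP_emeasure_incseq[symmetric])
      have "1 / real (Suc n) \<le> 1 / real (Suc m)" if "m \<le> n" for m n
        using that by (intro divide_left_mono) auto
      then show "incseq S" unfolding S_def incseq_def by (force simp del: of_nat_Suc)
    qed auto
    also have "\<dots> \<le> ennreal (?F b)"
    proof (rule SUP_least)
      fix n
      show "emeasure D (S n) \<le> ennreal (?F b)"
      proof (cases "1 / real (Suc n) < ?F b")
        case True
        obtain a where a: "a < b" "?F a = 1 / real (Suc n)"
          by (rule cdf_eq_below[OF cont _ True]) auto
        have "a \<le> x" if "x \<in> S n" for x
          using that a(2) cdf_nondecreasing[of x a] by (force simp: S_def)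
        then have "S n \<subseteq> {a..b}" by (auto simp: S_def)
        then have "emeasure D (S n) \<le> emeasure D {a..b}" by (intro emeasure_mono) auto
        also have "\<dots> \<le> ennreal (?F b)"
          using D_Icc[of a b] a cdf_nonneg[of a] by (simp add: ennreal_leI)
        finally show ?thesis .
      next
        case False
        then have "S n = {}" unfolding S_def using cdf_nondecreasing[of _ b] by force
        then show ?thesis by simp
      qed
    qed
    finally show "emeasure D {..b} \<le> ennreal (?F b)" .
    \<comment> \<open>Starting at a point where \<open>?F\<close> equals \<open>e\<close> loses only
      mass \<open>e\<close>.\<close>
    show "ennreal (?F b) \<le> emeasure D {..b}"
    proof (rule ennreal_le_epsilon)
      fix e :: real assume "0 < e"
      show "ennreal (?F b) \<le> emeasure D {..b} + ennreal e"
      proof (cases "e < ?F b")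
        case True
        obtain a where a: "a < b" "?F a = e"
          by (rule cdf_eq_below[OF cont \<open>0 < e\<close> True])
        have "ennreal (?F b) = ennreal (?F b - e) + ennreal e"
          using True \<open>0 < e\<close> by (simp flip: ennreal_plus)
        also have "ennreal (?F b - e) = emeasure D {a..b}"
          using D_Icc[of a b] a \<open>0 < e\<close> by simp
        also have "\<dots> \<le> emeasure D {..b}" by (intro emeasure_mono) auto
        finally show ?thesis by (simp add: add_right_mono)
      next
        case False
        then have "ennreal (?F b) \<le> ennreal e" by (intro ennreal_leI) simp
        then show ?thesis by (rule order_trans) simp
      qed
    qed
  qed
  \<comment> \<open>Finiteness of \<open>D\<close> is needed before its distribution function can
    identify it with \<open>M\<close>.\<close>
  have "emeasure D UNIV = (SUP n. emeasure D {..real n})"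
  proof -
    have "(\<Union>n. {..real n}) = UNIV" using real_arch_simple by auto
    then show ?thesis
      using SUP_emeasure_incseq[of "\<lambda>n. {..real n}" D] by (simp add: incseq_def image_subset_iff)
  qed
  also have "\<dots> \<le> 1"
    using cdf_bounded_prob by (intro SUP_least) (simp add: D_Iic)
  finally have "finite_measure D"
    by (intro finite_measureI) (auto simp: D_def top_unique)
  then have "finite_borel_measure D"
    by (intro finite_borel_measure.intro finite_borel_measure_axioms.intro) auto
  moreover have "cdf D = ?F"
    by (rule ext) (simp add: cdf_def2[of D] measure_def D_Iic cdf_nonneg)
  ultimately have "D = M"
    using cdf_unique'[OF _ finite_borel_measure_M] by blast
  then show ?thesis
    unfolding has_log_concave_density_def D_def using f_lc f_meas by blast
qed

end

section \<open>Both directions of the grid criterion\<close>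

theorem mainTheorem11:
  fixes \<nu> :: "real measure"
  assumes "prob_space \<nu>" and "sets \<nu> = sets borel"
  shows "(log_concave_measure \<nu> \<longrightarrow>
            (\<forall>h a. 0 < h \<longrightarrow>
               log_concave_seq (cell_prob \<nu> h a) \<and>
               int_interval {k. cell_prob \<nu> h a k > 0}))
       \<and> ((\<exists>(h :: nat \<Rightarrow> real) (a :: nat \<Rightarrow> real).
              (\<forall>n. 0 < h n) \<and> decseq h \<and> h \<longlonglongrightarrow> 0 \<and>
              (\<forall>n. int_interval {k. cell_prob \<nu> (h n) (a n) k > 0} \<and>
                   log_concave_seq (cell_prob \<nu> (h n) (a n))))
           \<longrightarrow> log_concave_measure \<nu> \<and> (point_mass \<nu> \<or> has_log_concave_density \<nu>))"
proof -
  interpret prob_space \<nu> by fact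
  interpret real_distribution \<nu> by standard fact
  show ?thesis
  proof (intro conjI impI allI; (elim exE conjE)?)
    fix h a :: "nat \<Rightarrow> real"
    assume h: "\<forall>n. 0 < h n" "h \<longlonglongrightarrow> 0"
      and grid: "\<forall>n. int_interval {k. cell_prob \<nu> (h n) (a n) k > 0} \<and>
                   log_concave_seq (cell_prob \<nu> (h n) (a n))"
    have inc: "log_concave_fun (\<lambda>x. cdf \<nu> (x + d) - cdf \<nu> x)" if "d > 0" for d
      using log_concave_increments[of h a, OF _ h(2) _ _ that] h(1) grid by blast
    \<comment> \<open>The dichotomy comes first, since log-concavity of \<nu> is deduced from either
      alternative.\<close>
    show "point_mass \<nu> \<or> has_log_concave_density \<nu>"
      using cdf_continuous_or_point_mass[OF cdf_log_concave[OF inc]]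
        has_log_concave_density_if_increments[OF _ inc] by blast
    then show "log_concave_measure \<nu>"
      using point_mass_imp_log_concave log_concave_density_imp_measure[OF finite_measure_axioms] by blast
  qed (use log_concave_measure_cells in auto)
qed

end
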